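(* Let $p$ be a positive integer, let $\Lambda>1$ and $M_1,\dots,M_{p-1}>1$. Let $$F(z)=\sum_{k=0}^{p-1}\bar z^{k}A_k(z)$$ be a poly-analytic function of order $p$ in $U$, where all $A_k$ are analytic in $U$ and satisfy $A_k(0)=0$, $A_k'(0)=1$ for $k\in\{0,\dots,p-1\}$, $|A_0'(z)|<\Lambda$ for all $z\in U$, and $|A_k(z)|\le M_k$ for all $z\in U$ and $k\in\{1,2,\dots,p-1\}$. Then $F$ is univalent in $U_{\rho_4}$ and $F(U_{\rho_4})$ contains the schlicht disk $U_{\sigma_4}$, where $\rho_4$ is the unique root in $(0,1)$ of the equation $$\Lambda\frac{1-\Lambda r}{\Lambda-r}-\sum_{k=1}^{p-1}\Big(M_k-\frac1{M_k}\Big)\frac{r^{k+1}\big(2-r+k(1-r)\big)}{(1-r)^2}-\sum_{k=1}^{p-1}(k+1)r^k=0,$$ and $$\sigma_4=\Lambda^2\rho_4+(\Lambda^3-\Lambda)\ln\Big(1-\frac{\rho_4}{\Lambda}\Big)-\rho_4^2\Big(\frac{1-\rho_4^{p-1}}{1-\rho_4}\Big)-\sum_{k=1}^{p-1}\Big(M_k-\frac1{M_k}\Big)\frac{\rho_4^{k+2}}{1-\rho_4}.$$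
   Context: For $r>0$, $U_r=\{z\in\mathbb C:|z|<r\}$ and $U=U_1$. A continuous function $F:D\to\mathbb C$ on a domain $D\subset\mathbb C$ is poly-analytic of order $p$ if $\partial^pF/\partial\bar z^p=0$ in $D$; in a simply connected domain this is equivalent to $F=\sum_{k=0}^{p-1}\bar z^kA_k(z)$ with all $A_k$ analytic. Univalent means injective. A schlicht disk in $F(U_\rho)$ is a disk that is the univalent image under $F$ of some region in $U_\rho$. Empty sums (when $p=1$) are $0$. *)

theory Defs
  imports "HOL-Complex_Analysis.Complex_Analysis"
begin

text \<open>The Wirtinger derivative with respect to the conjugate variable,
  \<open>(\<partial>/\<partial>x + \<i> \<partial>/\<partial>y) / 2\<close>, of a function that is differentiable in the real sense.\<close>

definition has_dbar :: "(complex \<Rightarrow> complex) \<Rightarrow> complex \<Rightarrow> complex \<Rightarrow> bool" where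
  "has_dbar F d z \<longleftrightarrow>
     (\<exists>F'. (F has_derivative F') (at z) \<and> d = (F' 1 + \<i> * F' \<i>) / 2)"

primrec iter_dbar_zero_on :: "nat \<Rightarrow> (complex \<Rightarrow> complex) \<Rightarrow> complex set \<Rightarrow> bool" where
  "iter_dbar_zero_on 0 F D \<longleftrightarrow> (\<forall>z\<in>D. F z = 0)"
| "iter_dbar_zero_on (Suc p) F D \<longleftrightarrow>
     (\<exists>G. (\<forall>z\<in>D. has_dbar F (G z) z) \<and> iter_dbar_zero_on p G D)"

definition polyanalytic_on :: "nat \<Rightarrow> (complex \<Rightarrow> complex) \<Rightarrow> complex set \<Rightarrow> bool" where
  "polyanalytic_on p F D \<longleftrightarrow> continuous_on D F \<and> iter_dbar_zero_on p F D"

lemma has_dbar_cong_open: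
  assumes "has_dbar f d z" "open D" "z \<in> D" "\<And>w. w \<in> D \<Longrightarrow> f w = g w"
  shows "has_dbar g d z"
proof -
  obtain f' where f': "(f has_derivative f') (at z)" "d = (f' 1 + \<i> * f' \<i>) / 2"
    using assms(1) unfolding has_dbar_def by auto
  have "(g has_derivative f') (at z)"
    using has_derivative_transform_within_open[OF f'(1) assms(2,3)] assms(4) by blast
  then show ?thesis unfolding has_dbar_def using f'(2) by blast
qed

lemma has_dbar_sum:
  assumes "\<And>i. i \<in> I \<Longrightarrow> has_dbar (f i) (d i) z"
  shows "has_dbar (\<lambda>w. \<Sum>i\<in>I. f i w) (\<Sum>i\<in>I. d i) z"
proof -
  obtain f' where f': "\<And>i. i \<in> I \<Longrightarrow>
      (f i has_derivative f' i) (at z) \<and> d i = (f' i 1 + \<i> * f' i \<i>) / 2"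
    using assms unfolding has_dbar_def by metis
  have "((\<lambda>w. \<Sum>i\<in>I. f i w) has_derivative (\<lambda>h. \<Sum>i\<in>I. f' i h)) (at z)"
    using f' by (intro has_derivative_sum) auto
  moreover have "(\<Sum>i\<in>I. d i) = (\<Sum>i\<in>I. (f' i 1 + \<i> * f' i \<i>) / 2)"
    using f' by (intro sum.cong) auto
  then have "(\<Sum>i\<in>I. d i) = ((\<Sum>i\<in>I. f' i 1) + \<i> * (\<Sum>i\<in>I. f' i \<i>)) / 2"
    by (simp add: sum_distrib_left sum_divide_distrib flip: sum.distrib)
  ultimately show ?thesis unfolding has_dbar_def by blast
qed

lemma has_dbar_cnj_power_mult:
  assumes "(A has_field_derivative a) (at z)"
  shows "has_dbar (\<lambda>w. cnj w ^ k * A w) (of_nat k * cnj z ^ (k - 1) * A z) z"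
proof -
  have A: "(A has_derivative (*) a) (at z)"
    using assms by (simp add: has_field_derivative_def)
  have C: "(cnj has_derivative cnj) (at z)"
    by (rule bounded_linear_imp_has_derivative) (rule bounded_linear_cnj)
  have P: "((\<lambda>w. cnj w ^ k) has_derivative (\<lambda>h. of_nat k * cnj h * cnj z ^ (k - 1))) (at z)"
    using has_derivative_power[OF C, of k] by (simp add: mult_ac)
  show ?thesis unfolding has_dbar_def
    by (intro exI conjI, rule has_derivative_mult[OF P A]) (simp add: algebra_simps)
qed

lemma iter_dbar_zero_on_cnj_sum:
  assumes "open D" "\<And>k. k < p \<Longrightarrow> A k holomorphic_on D"
    "\<And>z. z \<in> D \<Longrightarrow> F z = (\<Sum>k<p. cnj z ^ k * A k z)"
  shows "iter_dbar_zero_on p F D"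
  using assms
proof (induction p arbitrary: F A)
  case 0
  then show ?case by simp
next
  case (Suc p)
  define B where "B = (\<lambda>k w. of_nat (Suc k) * A (Suc k) w)"
  define G where "G = (\<lambda>z. \<Sum>k<p. cnj z ^ k * B k z)"
  have "iter_dbar_zero_on p G D"
  proof (rule Suc.IH[of B])
    show "B k holomorphic_on D" if "k < p" for k
      unfolding B_def using that by (intro holomorphic_intros Suc.prems) auto
  qed (auto simp: G_def Suc.prems)
  moreover have "has_dbar F (G z) z" if z: "z \<in> D" for z
  proof -
    have "has_dbar (\<lambda>w. \<Sum>k<Suc p. cnj w ^ k * A k w)
            (\<Sum>k<Suc p. of_nat k * cnj z ^ (k - 1) * A k z) z"
      using Suc.prems(1,2) z
      by (intro has_dbar_sum has_dbar_cnj_power_mult) (auto intro: holomorphic_derivI)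
    moreover have "(\<Sum>k<Suc p. of_nat k * cnj z ^ (k - 1) * A k z) = G z"
      unfolding G_def B_def by (subst sum.lessThan_Suc_shift) (simp add: mult_ac)
    ultimately have "has_dbar (\<lambda>w. \<Sum>k<Suc p. cnj w ^ k * A k w) (G z) z"
      by (simp only:)
    then show ?thesis
      using Suc.prems(1) z by (rule has_dbar_cong_open) (rule Suc.prems(3)[symmetric])
  qed
  ultimately show ?case
    unfolding iter_dbar_zero_on.simps by blast
qed

lemma polyanalytic_on_cnj_sum:
  assumes "open D" "\<And>k. k < p \<Longrightarrow> A k holomorphic_on D"
    "\<And>z. z \<in> D \<Longrightarrow> F z = (\<Sum>k<p. cnj z ^ k * A k z)"
  shows "polyanalytic_on p F D"
proof -
  have "continuous_on D (\<lambda>z. \<Sum>k<p. cnj z ^ k * A k z)"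
    using assms(2) by (intro continuous_intros) (auto intro: holomorphic_on_imp_continuous_on)
  then have "continuous_on D F" using assms(3) by (simp cong: continuous_on_cong)
  with iter_dbar_zero_on_cnj_sum[OF assms] show ?thesis
    by (simp add: polyanalytic_on_def)
qed

text \<open>The open disk with centre \<open>c\<close> and radius \<open>s\<close> is a schlicht disk in the image of \<open>S\<close>.
  Regions are nonempty, which forces \<open>s > 0\<close>.\<close>

definition schlicht_disk_in :: "(complex \<Rightarrow> complex) \<Rightarrow> complex set \<Rightarrow> complex \<Rightarrow> real \<Rightarrow> bool" where
  "schlicht_disk_in F S c s \<longleftrightarrow>
     (\<exists>\<Omega>. \<Omega> \<noteq> {} \<and> open \<Omega> \<and> connected \<Omega> \<and> \<Omega> \<subseteq> S \<and> inj_on F \<Omega> \<and> F ` \<Omega> = ball c s)"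

definition radius_fun :: "nat \<Rightarrow> real \<Rightarrow> (nat \<Rightarrow> real) \<Rightarrow> real \<Rightarrow> real" where
  "radius_fun p \<Lambda> M r =
     \<Lambda> * ((1 - \<Lambda> * r) / (\<Lambda> - r))
     - (\<Sum>k=1..p-1. (M k - 1 / M k) * (r ^ (k+1) * (2 - r + real k * (1 - r)) / (1 - r)^2))
     - (\<Sum>k=1..p-1. (real k + 1) * r ^ k)"

definition disk_radius :: "nat \<Rightarrow> real \<Rightarrow> (nat \<Rightarrow> real) \<Rightarrow> real \<Rightarrow> real" where
  "disk_radius p \<Lambda> M \<rho> =
     \<Lambda>^2 * \<rho> + (\<Lambda>^3 - \<Lambda>) * ln (1 - \<rho> / \<Lambda>)
     - \<rho>^2 * ((1 - \<rho> ^ (p-1)) / (1 - \<rho>))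
     - (\<Sum>k=1..p-1. (M k - 1 / M k) * (\<rho> ^ (k+2) / (1 - \<rho>)))"

end

(* Write r = |z|. Dividing A_k by z gives a function h bounded by M_k with h(0) = 1, and
   Schwarz-Pick for h bounds |A_k| and |A_k'| by the expressions that Taylor coefficient estimates
   |a_n| <= M_k - 1/M_k would give; Schwarz-Pick for A_0' bounds its real part below by
   \<Lambda>(1 - \<Lambda>r)/(\<Lambda> - r). Together, the real derivative D_z of F satisfies
   Re (conj u * D_z u) >= |u|^2 radius_fun r. On the disk of radius \<rho> this is positive, so F is
   injective along segments. Moreover radius_fun is the derivative of disk_radius, so integrating
   along a radius gives |F z| >= disk_radius \<rho> > 0 for |z| = \<rho>, and invariance of domain yields
   the schlicht disk. *)

theory Submission
  imports Defs
begin

section \<open>Schwarz-Pick inequalities on the unit disk\<close>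

text \<open>Schwarz's lemma for \<open>f\<close> conjugated by the disk automorphisms that move
  \<open>w\<close> and \<open>f w\<close> to 0. The quotients are multiplied out, so that later
  limits need no condition on denominators.\<close>

lemma Schwarz_Pick:
  assumes "f holomorphic_on ball 0 1" "\<And>z. cmod z < 1 \<Longrightarrow> cmod (f z) < 1"
    and z: "cmod z < 1" and w: "cmod w < 1"
  shows "cmod (f z - f w) * cmod (1 - cnj w * z) \<le> cmod (z - w) * cmod (1 - cnj (f w) * f z)"
proof -
  let ?M = "Moebius_function 0"
  define g where "g = ?M (f w) \<circ> (f \<circ> ?M (-w))"
  have fw: "cmod (f w) < 1" and mw: "cmod (-w) < 1"
    using assms by auto
  have nz: "1 - cnj a * b \<noteq> 0" if "cmod a < 1" "cmod b < 1" for a b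
  proof
    assume "1 - cnj a * b = 0"
    then have "cmod (cnj a * b) = 1" by (metis eq_iff_diff_eq_0 norm_one)
    then show False
      using that norm_mult_less[of "cnj a" 1 b 1] by simp
  qed
  have "g holomorphic_on ball 0 1"
    unfolding g_def
  proof (rule holomorphic_on_compose_gen[where t = "ball 0 1"])
    show "f \<circ> ?M (-w) holomorphic_on ball 0 1"
      by (rule holomorphic_on_compose_gen[where t = "ball 0 1"])
        (use assms mw Moebius_function_holomorphic Moebius_function_norm_lt_1 in auto)
    show "?M (f w) holomorphic_on ball 0 1"
      by (rule Moebius_function_holomorphic[OF fw])
    show "(f \<circ> ?M (-w)) ` ball 0 1 \<subseteq> ball 0 1"
      using assms mw Moebius_function_norm_lt_1 by auto
  qed
  moreover have "g 0 = 0"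
    by (simp add: g_def Moebius_function_of_zero Moebius_function_eq_zero)
  moreover have "cmod (g u) < 1" if "cmod u < 1" for u
    using that assms mw Moebius_function_norm_lt_1 by (simp add: g_def)
  moreover have "cmod (?M w z) < 1"
    using z w by (rule Moebius_function_norm_lt_1[rotated])
  ultimately have "cmod (g (?M w z)) \<le> cmod (?M w z)"
    by (rule Schwarz_Lemma(1))
  \<comment> \<open>\<open>?M (-w)\<close> is the inverse of \<open>?M w\<close>, so the inner
    automorphism cancels and leaves \<open>f z\<close>.\<close>
  moreover have "g (?M w z) = ?M (f w) (f z)"
    using Moebius_function_compose[of "-w" w z] z mw by (simp add: g_def)
  ultimately have "cmod ((f z - f w) / (1 - cnj (f w) * f z)) \<le> cmod ((z - w) / (1 - cnj w * z))"
    by (simp add: Moebius_function_simple)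
  moreover have "1 - cnj (f w) * f z \<noteq> 0" "1 - cnj w * z \<noteq> 0"
    using nz assms fw by auto
  ultimately show ?thesis
    by (simp add: norm_divide field_simps)
qed

text \<open>The bound \<open>M\<close> may be attained, so \<open>f / M\<close> need not map into
  the open disk. The strict version is applied to \<open>f / K\<close> with \<open>K > M\<close>,
  and then \<open>K\<close> tends to \<open>M\<close> from the right.\<close>

lemma Schwarz_Pick_bounded:
  assumes "f holomorphic_on ball 0 1" "\<And>z. cmod z < 1 \<Longrightarrow> cmod (f z) \<le> M"
    and "0 < M" and z: "cmod z < 1" and w: "cmod w < 1"
  shows "M * cmod (f z - f w) * cmod (1 - cnj w * z)
    \<le> cmod (z - w) * cmod (of_real (M^2) - cnj (f w) * f z)"
proof -
  have strict: "K * cmod (f z - f w) * cmod (1 - cnj w * z)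
      \<le> cmod (z - w) * cmod (of_real (K^2) - cnj (f w) * f z)" if "K > M" for K
  proof -
    have K: "K > 0" using that \<open>0 < M\<close> by simp
    have "cmod (f z / K - f w / K) * cmod (1 - cnj w * z)
        \<le> cmod (z - w) * cmod (1 - cnj (f w / K) * (f z / K))"
    proof (rule Schwarz_Pick[OF _ _ z w])
      show "(\<lambda>z. f z / K) holomorphic_on ball 0 1"
        using assms(1) K by (auto intro!: holomorphic_intros)
      show "cmod (f z / K) < 1" if "cmod z < 1" for z
        using assms(2)[OF that] \<open>K > M\<close> K by (simp add: norm_divide)
    qed
    moreover have "f z / K - f w / K = (f z - f w) / K"
      by (simp add: diff_divide_distrib)
    moreover have "1 - cnj (f w / K) * (f z / K) = (of_real (K^2) - cnj (f w) * f z) / of_real (K^2)"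
      using K by (simp add: field_simps power2_eq_square)
    ultimately have "cmod (f z - f w) / K * cmod (1 - cnj w * z)
        \<le> cmod (z - w) * (cmod (of_real (K^2) - cnj (f w) * f z) / K^2)"
      using K by (simp only: norm_divide norm_of_real) simp
    then show ?thesis
      using K by (simp add: field_simps power2_eq_square)
  qed
  show ?thesis
  proof (rule tendsto_le[where F = "at_right M"])
    show "((\<lambda>K. K * cmod (f z - f w) * cmod (1 - cnj w * z))
      \<longlongrightarrow> M * cmod (f z - f w) * cmod (1 - cnj w * z)) (at_right M)"
      by (intro tendsto_intros)
    show "((\<lambda>K. cmod (z - w) * cmod (of_real (K^2) - cnj (f w) * f z))
      \<longlongrightarrow> cmod (z - w) * cmod (of_real (M^2) - cnj (f w) * f z)) (at_right M)"
      by (intro tendsto_intros)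
    show "\<forall>\<^sub>F K in at_right M. K * cmod (f z - f w) * cmod (1 - cnj w * z)
      \<le> cmod (z - w) * cmod (of_real (K^2) - cnj (f w) * f z)"
      using strict by (auto simp: eventually_at_right_field intro!: exI[of _ "M + 1"])
  qed simp
qed

text \<open>The two-point inequality is divided by \<open>cmod (z - w)\<close>, and then
  \<open>z\<close> tends to \<open>w\<close>.\<close>

lemma Schwarz_Pick_deriv:
  assumes f: "f holomorphic_on ball 0 1" and bound: "\<And>z. cmod z < 1 \<Longrightarrow> cmod (f z) \<le> M"
    and "0 < M" and w: "cmod w < 1"
  shows "M * cmod (deriv f w) * (1 - (cmod w)^2) \<le> M^2 - (cmod (f w))^2"
proof -
  have "(f has_field_derivative deriv f w) (at w)"
    using holomorphic_derivI[OF f open_ball] w by simp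
  then have lim: "((\<lambda>z. (f z - f w) / (z - w)) \<longlongrightarrow> deriv f w) (at w)" "(f \<longlongrightarrow> f w) (at w)"
    using DERIV_isCont[unfolded isCont_def] by (auto simp: has_field_derivative_iff)
  have "M * cmod (deriv f w) * cmod (1 - cnj w * w) \<le> cmod (of_real (M^2) - cnj (f w) * f w)"
  proof (rule tendsto_le[where F = "at w"])
    show "((\<lambda>z. M * cmod ((f z - f w) / (z - w)) * cmod (1 - cnj w * z))
      \<longlongrightarrow> M * cmod (deriv f w) * cmod (1 - cnj w * w)) (at w)"
      by (intro tendsto_intros lim)
    show "((\<lambda>z. cmod (of_real (M^2) - cnj (f w) * f z))
      \<longlongrightarrow> cmod (of_real (M^2) - cnj (f w) * f w)) (at w)"
      by (intro tendsto_intros lim)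
    have "\<forall>\<^sub>F z in at w. z \<in> ball 0 1 \<and> z \<noteq> w"
      using w by (intro eventually_conj eventually_at_in_open' eventually_neq_at_within) auto
    then show "\<forall>\<^sub>F z in at w. M * cmod ((f z - f w) / (z - w)) * cmod (1 - cnj w * z)
        \<le> cmod (of_real (M^2) - cnj (f w) * f z)"
    proof (rule eventually_mono)
      fix z assume "z \<in> ball 0 1 \<and> z \<noteq> w"
      then show "M * cmod ((f z - f w) / (z - w)) * cmod (1 - cnj w * z)
        \<le> cmod (of_real (M^2) - cnj (f w) * f z)"
        using Schwarz_Pick_bounded[OF f bound \<open>0 < M\<close>, of z w] w
        by (simp add: norm_divide field_simps)
    qed
  qed simp
  \<comment> \<open>In the limit both complex factors are real and nonnegative, so their moduli are
    the numbers themselves.\<close>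
  moreover have "1 - cnj w * w = of_real (1 - (cmod w)^2)"
    "of_real (M^2) - cnj (f w) * f w = of_real (M^2 - (cmod (f w))^2)"
    by (simp_all add: complex_norm_square mult.commute del: of_real_power)
  moreover have "(cmod w)^2 \<le> 1" "(cmod (f w))^2 \<le> M^2"
    using w bound[OF w] by (auto intro: power_mono simp: abs_square_le_1)
  ultimately show ?thesis
    by (simp only: norm_of_real abs_of_nonneg diff_ge_0_iff_ge)
qed

lemma Schwarz_bounded:
  assumes f: "f holomorphic_on ball 0 1" and "f 0 = 0"
    and bound: "\<And>z. cmod z < 1 \<Longrightarrow> cmod (f z) \<le> M" and "0 < M" and z: "cmod z < 1"
  shows "cmod (f z) \<le> M * cmod z"
  using Schwarz_Pick_bounded[OF f bound \<open>0 < M\<close> z, of 0] assms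
  by (simp add: norm_mult power2_eq_square mult_ac)

section \<open>Growth estimates for bounded analytic functions with prescribed value or derivative
  at 0\<close>

text \<open>Schwarz-Pick against the point 0 confines \<open>f z\<close> to an Apollonius disk with
  real centre; the bound is its leftmost point. It serves both for \<open>A_0'\<close> and for the
  derivative estimate below.\<close>

lemma Re_ge_of_bounded:
  assumes f: "f holomorphic_on ball 0 1" and "f 0 = 1"
    and bound: "\<And>z. cmod z < 1 \<Longrightarrow> cmod (f z) \<le> L" and "1 < L" and z: "cmod z < 1"
  shows "L * (1 - L * cmod z) / (L - cmod z) \<le> Re (f z)"
proof -
  define r x y where "r = cmod z" and "x = Re (f z)" and "y = Im (f z)"
  have r: "0 \<le> r" "r < 1" using z by (auto simp: r_def)
  have "x \<le> L" using bound[OF z] complex_Re_le_cmod[of "f z"] by (simp add: x_def)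
  have "L * cmod (f z - 1) \<le> r * cmod (of_real (L^2) - f z)"
    using Schwarz_Pick_bounded[OF f bound, of z 0] assms by (simp add: r_def)
  then have "(L * cmod (f z - 1))^2 \<le> (r * cmod (of_real (L^2) - f z))^2"
    using \<open>1 < L\<close> by (intro power_mono) auto
  then have "L^2 * ((x - 1)^2 + y^2) \<le> r^2 * ((L^2 - x)^2 + y^2)"
    by (simp add: power_mult_distrib cmod_power2 x_def y_def)
  \<comment> \<open>Since r \<le> L, the imaginary parts cancel in the favourable direction, and an
    inequality between two squares in \<open>x\<close> remains.\<close>
  moreover have "r^2 * y^2 \<le> L^2 * y^2"
    using r \<open>1 < L\<close> by (intro mult_right_mono power_mono) auto
  ultimately have "(L * (x - 1))^2 \<le> (r * (L^2 - x))^2"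
    unfolding power_mult_distrib distrib_left by linarith
  moreover have "0 \<le> r * (L^2 - x)"
    using r \<open>x \<le> L\<close> \<open>1 < L\<close> self_le_power[of L 2] by simp
  ultimately have "\<bar>L * (x - 1)\<bar> \<le> r * (L^2 - x)"
    using power2_le_imp_le[of "\<bar>L * (x - 1)\<bar>" "r * (L^2 - x)"] by (simp only: power2_abs)
  then have "L * (1 - x) \<le> r * (L^2 - x)" by (simp add: abs_le_iff algebra_simps)
  then have "L * (1 - L * r) \<le> x * (L - r)" by (simp add: algebra_simps power2_eq_square)
  then show ?thesis
    using r \<open>1 < L\<close> by (simp add: pos_divide_le_eq r_def x_def)
qed

text \<open>The right side is the sum of \<open>(M - 1 / M) * r^n\<close> over n \<ge> 1, as if
  every Taylor coefficient were bounded by \<open>M - 1 / M\<close>. It follows from Schwarz-Pick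
  against 0 once \<open>M^2 - f z\<close> is split around the value 1.\<close>

lemma norm_diff_one_le_of_bounded:
  assumes f: "f holomorphic_on ball 0 1" and "f 0 = 1"
    and bound: "\<And>z. cmod z < 1 \<Longrightarrow> cmod (f z) \<le> M" and "1 < M" and z: "cmod z < 1"
  shows "cmod (f z - 1) \<le> (M - 1 / M) * (cmod z / (1 - cmod z))"
proof -
  define r d where "r = cmod z" and "d = cmod (f z - 1)"
  have r: "0 \<le> r" "r < 1" using z by (auto simp: r_def)
  have M: "M^2 - 1 > 0" using \<open>1 < M\<close> by (simp add: one_less_power)
  have d: "0 \<le> d" by (simp add: d_def)
  have "M * d \<le> r * cmod (of_real (M^2) - f z)"
    using Schwarz_Pick_bounded[OF f bound, of z 0] assms by (simp add: r_def d_def)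
  also have "complex_of_real (M^2) - f z = of_real (M^2 - 1) - (f z - 1)" by simp
  also have "cmod \<dots> \<le> cmod (of_real (M^2 - 1)) + d"
    unfolding d_def by (rule norm_triangle_ineq4)
  also have "cmod (of_real (M^2 - 1)) = M^2 - 1" using M by (simp only: norm_of_real abs_of_pos)
  finally have "M * d \<le> r * (M^2 - 1 + d)" using r by (simp add: mult_left_mono)
  moreover have "r * d \<le> r * (M * d)"
    using r d \<open>1 < M\<close> by (intro mult_left_mono) (auto simp: mult_le_cancel_right1)
  ultimately have "d * M * (1 - r) \<le> (M^2 - 1) * r" by (simp add: algebra_simps)
  then show ?thesis
    using r \<open>1 < M\<close> unfolding r_def[symmetric] d_def[symmetric]
    by (simp add: field_simps power2_eq_square)
qed

text \<open>The right side is the sum of \<open>(M - 1 / M) * n * r^(n-1)\<close> over n \<ge> 1.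
  The derivative form of Schwarz-Pick is combined with a lower bound for \<open>cmod (f z)\<close>,
  which comes from the bound on the real part.\<close>

lemma norm_deriv_le_of_bounded:
  assumes f: "f holomorphic_on ball 0 1" and "f 0 = 1"
    and bound: "\<And>z. cmod z < 1 \<Longrightarrow> cmod (f z) \<le> M" and "1 < M" and z: "cmod z < 1"
  shows "cmod (deriv f z) \<le> (M - 1 / M) / (1 - cmod z)^2"
proof -
  define r d where "r = cmod z" and "d = cmod (deriv f z)"
  have r: "0 \<le> r" "r < 1" using z by (auto simp: r_def)
  then have r1: "1 - r^2 > 0" by (simp add: power_less_one_iff abs_square_less_1)
  have main: "M * d * (1 - r^2) \<le> M^2 - (cmod (f z))^2"
    using Schwarz_Pick_deriv[OF f bound, of z] assms by (simp add: r_def d_def)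
  have "d * M * (1 - r)^2 \<le> M^2 - 1"
  \<comment> \<open>The lower bound \<open>q\<close> for \<open>cmod (f z)\<close> has the sign of
    \<open>1 - M * r\<close>. It can be squared only when nonnegative; for larger \<open>r\<close>,
    dropping \<open>(cmod (f z))^2\<close> is affordable.\<close>
  proof (cases "1 \<le> M * r")
    case True
    then have "M * 1 \<le> M * (M * r)" using \<open>1 < M\<close> by (intro mult_left_mono) auto
    then have "M^2 * r \<ge> 1" using \<open>1 < M\<close> unfolding power2_eq_square by linarith
    \<comment> \<open>Expanded, this says 1 + r \<le> 2 * M^2 * r.\<close>
    then have *: "M^2 * (1 - r) \<le> (M^2 - 1) * (1 + r)" using r by (simp add: algebra_simps)
    have "M * d * (1 - r^2) \<le> M^2" using main zero_le_power2[of "cmod (f z)"] by linarith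
    then have "(M * d * (1 - r^2)) * (1 - r) \<le> M^2 * (1 - r)"
      using r by (intro mult_right_mono) auto
    then have "(M * d * (1 - r)^2) * (1 + r) \<le> (M^2 - 1) * (1 + r)"
      using * by (simp add: power2_eq_square algebra_simps)
    then show ?thesis using r by (simp add: mult.commute)
  next
    case False
    define q where "q = M * (1 - M * r) / (M - r)"
    have "q \<ge> 0" unfolding q_def using False r \<open>1 < M\<close> by (intro divide_nonneg_pos mult_nonneg_nonneg) auto
    moreover have "q \<le> cmod (f z)"
      using Re_ge_of_bounded[OF f _ bound, of z] assms complex_Re_le_cmod[of "f z"]
      by (simp add: q_def r_def)
    ultimately have "q^2 \<le> (cmod (f z))^2" by (intro power_mono)
    then have "M * d * (1 - r^2) \<le> M^2 - q^2" using main by simp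
    then have "M * d * (1 - r^2) * (M - r)^2 \<le> (M^2 - q^2) * (M - r)^2"
      by (rule mult_right_mono) simp
    also have "\<dots> = M^2 * (M - r)^2 - (q * (M - r))^2" by (simp only: left_diff_distrib power_mult_distrib)
    also have "q * (M - r) = M * (1 - M * r)" using r \<open>1 < M\<close> by (simp add: q_def)
    \<comment> \<open>The factor \<open>1 - r^2\<close> splits off and cancels the one on the
      left.\<close>
    also have "M^2 * (M - r)^2 - (M * (1 - M * r))^2 = M^2 * (M^2 - 1) * (1 - r^2)"
      by (simp add: algebra_simps power2_eq_square)
    finally have "M * d * (M - r)^2 \<le> M^2 * (M^2 - 1)"
      using r1 by (simp add: mult.commute mult.left_commute)
    \<comment> \<open>Weakening \<open>M - r\<close> to \<open>M * (1 - r)\<close> trades the sharp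
      bound for the power series form.\<close>
    moreover have "(M * (1 - r))^2 \<le> (M - r)^2"
      using r \<open>1 < M\<close> by (intro power_mono) (auto simp: right_diff_distrib mult_le_cancel_right1)
    then have "M * d * (M * (1 - r))^2 \<le> M * d * (M - r)^2"
      using \<open>1 < M\<close> by (intro mult_left_mono) (auto simp: d_def)
    then have "M^2 * (M * d * (1 - r)^2) \<le> M * d * (M - r)^2"
      by (simp add: power_mult_distrib mult_ac)
    ultimately have "M^2 * (M * d * (1 - r)^2) \<le> M^2 * (M^2 - 1)" by linarith
    then show ?thesis using \<open>1 < M\<close> by (simp add: mult.commute)
  qed
  moreover have "(M - 1 / M) / (1 - r)^2 = (M^2 - 1) / (M * (1 - r)^2)"
    using \<open>1 < M\<close> by (simp add: field_simps power2_eq_square)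
  ultimately show ?thesis
    using r \<open>1 < M\<close> unfolding r_def[symmetric] d_def[symmetric]
    by (simp add: pos_le_divide_eq mult.assoc)
qed

text \<open>Write \<open>A z = z * h z\<close>. Schwarz's lemma gives the bound \<open>M\<close> for
  \<open>h\<close>, and \<open>h 0 = deriv A 0 = 1\<close>, so the two preceding estimates apply to
  \<open>h\<close>.\<close>

lemma bounded_holomorphic_estimates:
  assumes A: "A holomorphic_on ball 0 1" and "A 0 = 0" and "deriv A 0 = 1"
    and bound: "\<And>z. cmod z < 1 \<Longrightarrow> cmod (A z) \<le> M" and "1 < M" and z: "cmod z < 1"
  shows "cmod (A z) \<le> cmod z + (M - 1 / M) * ((cmod z)^2 / (1 - cmod z))"
    and "cmod (deriv A z) \<le> 1 + (M - 1 / M) * (cmod z * (2 - cmod z) / (1 - cmod z)^2)"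
proof -
  obtain h where h: "h holomorphic_on ball 0 1" "\<And>z. cmod z < 1 \<Longrightarrow> A z = z * h z" "h 0 = 1"
    using Schwarz3[OF A \<open>A 0 = 0\<close>] \<open>deriv A 0 = 1\<close> by metis
  have "cmod (h z) \<le> M" if "cmod z < 1" for z
  proof (cases "z = 0")
    case False
    then show ?thesis
      using Schwarz_bounded[OF A \<open>A 0 = 0\<close> bound _ that] \<open>1 < M\<close> h(2)[OF that]
      by (simp add: norm_mult mult.commute)
  qed (use h \<open>1 < M\<close> in auto)
  note bounds = norm_diff_one_le_of_bounded[OF h(1,3) this \<open>1 < M\<close> z]
    norm_deriv_le_of_bounded[OF h(1,3) this \<open>1 < M\<close> z]
  have "A z = z + z * (h z - 1)" using h(2)[OF z] by (simp add: algebra_simps)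
  then have "cmod (A z) \<le> cmod z + cmod z * cmod (h z - 1)"
    by (metis norm_mult norm_triangle_ineq)
  also have "\<dots> \<le> cmod z + cmod z * ((M - 1 / M) * (cmod z / (1 - cmod z)))"
    using bounds(1) by (intro add_left_mono mult_left_mono) auto
  finally show "cmod (A z) \<le> cmod z + (M - 1 / M) * ((cmod z)^2 / (1 - cmod z))"
    by (simp add: power2_eq_square mult_ac)
  have "((\<lambda>z. z * h z) has_field_derivative (h z + z * deriv h z)) (at z)"
    using holomorphic_derivI[OF h(1) open_ball, of z] z
    by (auto intro!: derivative_eq_intros)
  then have "(A has_field_derivative (h z + z * deriv h z)) (at z)"
    by (rule has_field_derivative_transform_within_open[where S = "ball 0 1"]) (use z h in auto)
  \<comment> \<open>Isolating the value 1 of the derivative at 0 leaves two terms, one for each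
    estimate on \<open>h\<close>.\<close>
  then have "deriv A z = 1 + ((h z - 1) + z * deriv h z)" by (simp add: DERIV_imp_deriv)
  then have "cmod (deriv A z) \<le> 1 + (cmod (h z - 1) + cmod z * cmod (deriv h z))"
    by (metis norm_mult norm_one norm_triangle_ineq norm_triangle_le add_left_mono order_trans)
  also have "\<dots> \<le> 1 + ((M - 1 / M) * (cmod z / (1 - cmod z)) + cmod z * ((M - 1 / M) / (1 - cmod z)^2))"
    using bounds by (intro add_left_mono add_mono mult_left_mono) auto
  also have "\<dots> = 1 + (M - 1 / M) * (cmod z / (1 - cmod z) + cmod z / (1 - cmod z)^2)"
    by (simp add: algebra_simps)
  also have "cmod z / (1 - cmod z) + cmod z / (1 - cmod z)^2 = cmod z * (2 - cmod z) / (1 - cmod z)^2"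
    using z by (simp add: divide_simps power2_eq_square) (simp add: algebra_simps)
  finally show "cmod (deriv A z) \<le> 1 + (M - 1 / M) * (cmod z * (2 - cmod z) / (1 - cmod z)^2)" .
qed


section \<open>Injectivity and covering from a lower bound on the real derivative\<close>

text \<open>A real form of the Noshiro-Warschawski argument: along the segment from \<open>x\<close>
  to \<open>y\<close>, the component of \<open>F\<close> in the direction \<open>u = y - x\<close>
  is strictly increasing.\<close>

lemma inj_on_of_inner_derivative_pos:
  fixes F :: "'a::real_inner \<Rightarrow> 'a"
  assumes "convex S" and D: "\<And>z. z \<in> S \<Longrightarrow> (F has_derivative D z) (at z)"
    and pos: "\<And>z u. z \<in> S \<Longrightarrow> u \<noteq> 0 \<Longrightarrow> 0 < u \<bullet> D z u"
  shows "inj_on F S"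
proof (rule inj_onI, rule ccontr)
  fix x y assume x: "x \<in> S" and y: "y \<in> S" and eq: "F x = F y" and "x \<noteq> y"
  define u where "u = y - x"
  define c where "c = (\<lambda>t::real. x + t *\<^sub>R u)"
  have c: "c t \<in> S" if "0 \<le> t" "t \<le> 1" for t
  proof -
    have "c t = (1 - t) *\<^sub>R x + t *\<^sub>R y" by (simp add: c_def u_def algebra_simps)
    then show ?thesis using convexD_alt[OF \<open>convex S\<close> x y that] by simp
  qed
  have "\<exists>d. ((\<lambda>t. u \<bullet> F (c t)) has_real_derivative d) (at t) \<and> 0 < d" if t: "0 \<le> t" "t \<le> 1" for t
  proof (intro exI conjI)
    have "(c has_derivative (\<lambda>h. h *\<^sub>R u)) (at t)"
      unfolding c_def by (auto intro!: derivative_eq_intros)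
    then have "((\<lambda>t. F (c t)) has_derivative (\<lambda>h. D (c t) (h *\<^sub>R u))) (at t)"
      using D[OF c[OF t]] by (rule has_derivative_compose)
    then have "((\<lambda>t. u \<bullet> F (c t)) has_derivative (\<lambda>h. u \<bullet> D (c t) (h *\<^sub>R u))) (at t)"
      by (rule has_derivative_inner_right)
    moreover have "u \<bullet> D (c t) (h *\<^sub>R u) = (u \<bullet> D (c t) u) * h" for h
      using has_derivative_bounded_linear[OF D[OF c[OF t]]] by (simp add: linear_simps)
    ultimately show "((\<lambda>t. u \<bullet> F (c t)) has_real_derivative (u \<bullet> D (c t) u)) (at t)"
      by (simp add: has_field_derivative_def)
    show "0 < u \<bullet> D (c t) u"
      using pos[OF c[OF t]] \<open>x \<noteq> y\<close> by (simp add: u_def)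
  qed
  then have "u \<bullet> F (c 0) < u \<bullet> F (c 1)"
    using DERIV_pos_imp_increasing[of 0 1 "\<lambda>t. u \<bullet> F (c t)"] by simp
  then show False by (simp add: c_def u_def eq)
qed

text \<open>On the radius through \<open>z\<close>, the radial component of \<open>F\<close> minus
  \<open>g\<close> starts at 0 and has nonnegative derivative; Cauchy-Schwarz then passes from the
  component to the norm.\<close>

lemma norm_ge_of_inner_derivative_ge:
  fixes F :: "'a::real_inner \<Rightarrow> 'a"
  assumes D: "\<And>z. norm z \<le> \<rho> \<Longrightarrow> (F has_derivative D z) (at z)"
    and lower: "\<And>z u. norm z \<le> \<rho> \<Longrightarrow> (norm u)^2 * g' (norm z) \<le> u \<bullet> D z u"
    and g: "\<And>r. 0 \<le> r \<Longrightarrow> r \<le> \<rho> \<Longrightarrow> (g has_real_derivative g' r) (at r)"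
    and "F 0 = 0" "g 0 = 0" "0 < \<rho>" and z: "norm z = \<rho>"
  shows "g \<rho> \<le> norm (F z)"
proof -
  define u where "u = z /\<^sub>R \<rho>"
  have u: "norm u = 1" "\<rho> *\<^sub>R u = z" using z \<open>0 < \<rho>\<close> by (auto simp: u_def)
  have "\<exists>d. ((\<lambda>t. u \<bullet> F (t *\<^sub>R u) - g t) has_real_derivative d) (at t) \<and> 0 \<le> d"
    if t: "0 \<le> t" "t \<le> \<rho>" for t
  proof (intro exI conjI)
    have n: "norm (t *\<^sub>R u) = t" using u t by simp
    note Dt = D[of "t *\<^sub>R u", unfolded n, OF t(2)]
    have "((\<lambda>t. t *\<^sub>R u) has_derivative (\<lambda>h. h *\<^sub>R u)) (at t)"
      by (auto intro!: derivative_eq_intros)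
    then have "((\<lambda>t. F (t *\<^sub>R u)) has_derivative (\<lambda>h. D (t *\<^sub>R u) (h *\<^sub>R u))) (at t)"
      using Dt by (rule has_derivative_compose)
    then have "((\<lambda>t. u \<bullet> F (t *\<^sub>R u)) has_derivative (\<lambda>h. u \<bullet> D (t *\<^sub>R u) (h *\<^sub>R u))) (at t)"
      by (rule has_derivative_inner_right)
    moreover have "u \<bullet> D (t *\<^sub>R u) (h *\<^sub>R u) = (u \<bullet> D (t *\<^sub>R u) u) * h" for h
      using has_derivative_bounded_linear[OF Dt] by (simp add: linear_simps)
    ultimately have "((\<lambda>t. u \<bullet> F (t *\<^sub>R u)) has_real_derivative (u \<bullet> D (t *\<^sub>R u) u)) (at t)"
      by (simp add: has_field_derivative_def)
    then show "((\<lambda>t. u \<bullet> F (t *\<^sub>R u) - g t) has_real_derivative (u \<bullet> D (t *\<^sub>R u) u - g' t)) (at t)"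
      using g[OF t] by (rule DERIV_diff)
    show "0 \<le> u \<bullet> D (t *\<^sub>R u) u - g' t"
      using lower[of "t *\<^sub>R u" u, unfolded n, OF t(2)] u by simp
  qed
  then have "u \<bullet> F (0 *\<^sub>R u) - g 0 \<le> u \<bullet> F (\<rho> *\<^sub>R u) - g \<rho>"
    using DERIV_nonneg_imp_nondecreasing[of 0 \<rho> "\<lambda>t. u \<bullet> F (t *\<^sub>R u) - g t"] \<open>0 < \<rho>\<close> by simp
  then have "g \<rho> \<le> u \<bullet> F z" using assms u by simp
  also have "\<dots> \<le> norm (F z)" using norm_cauchy_schwarz[of u "F z"] u by simp
  finally show ?thesis .
qed

text \<open>By invariance of domain the image of the open disk is open, and its frontier points are
  values of \<open>F\<close> on the bounding circle, hence outside \<open>ball 0 \<sigma>\<close>.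
  That ball is connected and meets the image in \<open>F 0 = 0\<close>, so it lies in the
  image.\<close>

lemma schlicht_disk_in_of_boundary_bound:
  assumes cont: "continuous_on (cball 0 \<rho>) F" and inj: "inj_on F (ball 0 \<rho>)"
    and "F 0 = 0" "0 < \<rho>" "0 < \<sigma>" and bd: "\<And>z. cmod z = \<rho> \<Longrightarrow> \<sigma> \<le> cmod (F z)"
  shows "schlicht_disk_in F (ball 0 \<rho>) 0 \<sigma>"
proof -
  have contb: "continuous_on (ball 0 \<rho>) F"
    using cont ball_subset_cball by (rule continuous_on_subset)
  have op: "open (F ` ball 0 \<rho>)" by (intro invariance_of_domain contb inj open_ball)
  have "closed (F ` cball 0 \<rho>)"
    by (intro compact_imp_closed compact_continuous_image cont compact_cball)
  then have "closure (F ` ball 0 \<rho>) \<subseteq> F ` cball 0 \<rho>"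
    by (intro closure_minimal image_mono ball_subset_cball)
  then have "frontier (F ` ball 0 \<rho>) \<subseteq> F ` cball 0 \<rho> - F ` ball 0 \<rho>"
    unfolding frontier_def interior_open[OF op] by (rule Diff_mono) simp
  moreover have "F z \<notin> ball 0 \<sigma>" if "F z \<notin> F ` ball 0 \<rho>" "z \<in> cball 0 \<rho>" for z
  proof -
    have "z \<notin> ball 0 \<rho>" using that(1) by blast
    then show ?thesis using bd[of z] that(2) by simp
  qed
  ultimately have "ball 0 \<sigma> \<inter> frontier (F ` ball 0 \<rho>) = {}" by blast
  moreover have "ball 0 \<sigma> \<inter> F ` ball 0 \<rho> \<noteq> {}"
  proof -
    have "F 0 \<in> ball 0 \<sigma>" "F 0 \<in> F ` ball 0 \<rho>" using assms(3-5) by simp_all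
    then show ?thesis by blast
  qed
  ultimately have sub: "ball 0 \<sigma> \<subseteq> F ` ball 0 \<rho>"
    using connected_Int_frontier[OF connected_ball] unfolding Diff_eq_empty_iff[symmetric] by metis
  obtain g where g: "homeomorphism (ball 0 \<rho>) (F ` ball 0 \<rho>) F g"
    using invariance_of_domain_homeomorphism[OF open_ball contb _ inj] by blast
  have Fg: "F (g w) = w" "g w \<in> ball 0 \<rho>" if "w \<in> ball 0 \<sigma>" for w
    using homeomorphism_apply2[OF g] homeomorphism_image2[OF g] subsetD[OF sub that] by blast+
  \<comment> \<open>The required region is the preimage of the ball. Invariance of domain for the
    inverse \<open>g\<close> makes it open, and continuity of \<open>g\<close> makes it
    connected.\<close>
  define \<Omega> where "\<Omega> = g ` ball 0 \<sigma>"
  have \<Omega>: "\<Omega> \<subseteq> ball 0 \<rho>" "F ` \<Omega> = ball 0 \<sigma>"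
    using Fg by (simp_all add: \<Omega>_def image_image image_subset_iff)
  have cont_g: "continuous_on (ball 0 \<sigma>) g"
    using homeomorphism_cont2[OF g] sub by (rule continuous_on_subset)
  moreover from Fg(1) have "inj_on g (ball 0 \<sigma>)"
    by (rule inj_on_inverseI)
  ultimately have "open \<Omega>"
    unfolding \<Omega>_def using open_ball by (intro invariance_of_domain)
  moreover have "connected \<Omega>"
    unfolding \<Omega>_def using cont_g connected_ball by (rule connected_continuous_image)
  moreover have "\<Omega> \<noteq> {}" using \<open>0 < \<sigma>\<close> by (simp add: \<Omega>_def)
  moreover have "inj_on F \<Omega>" using inj \<Omega>(1) by (rule inj_on_subset)
  ultimately show ?thesis
    unfolding schlicht_disk_in_def using \<Omega> by (intro exI[of _ \<Omega>]) simp
qed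

section \<open>The radius equation and the radius of the covered disk\<close>

text \<open>The first term decreases strictly and the subtracted sums are nondecreasing, so
  strictness survives when the sums are empty. This gives uniqueness of the root and positivity to
  its left.\<close>

lemma radius_fun_strict_decreasing:
  assumes "1 < \<Lambda>" and M: "\<And>k. k \<in> {1..p-1} \<Longrightarrow> 1 < M k"
    and "0 \<le> r" "r < s" "s < 1"
  shows "radius_fun p \<Lambda> M s < radius_fun p \<Lambda> M r"
proof -
  \<comment> \<open>This is the difference of the cross-multiplied fractions compared next.\<close>
  have "0 < (s - r) * (\<Lambda>^2 - 1)" using assms by (simp add: one_less_power)
  then have "(1 - \<Lambda> * s) / (\<Lambda> - s) < (1 - \<Lambda> * r) / (\<Lambda> - r)"
    using assms by (simp add: field_simps power2_eq_square)
  then have 1: "\<Lambda> * ((1 - \<Lambda> * s) / (\<Lambda> - s)) < \<Lambda> * ((1 - \<Lambda> * r) / (\<Lambda> - r))"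
    using \<open>1 < \<Lambda>\<close> by (intro mult_strict_left_mono) auto
  \<comment> \<open>From \<open>2 - x + k * (1 - x) = 1 + (k + 1) * (1 - x)\<close>. Every factor on
    the right is visibly increasing, while the bracket on the left decreases in
    \<open>x\<close>.\<close>
  have eq: "x ^ (k+1) * (2 - x + real k * (1 - x)) / (1 - x)^2
      = x ^ (k+1) * (1 / (1 - x)^2 + (real k + 1) / (1 - x))" if "x < 1" for x :: real and k
    using that by (simp add: divide_simps power2_eq_square) (simp add: algebra_simps)
  have 2: "(M k - 1 / M k) * (r ^ (k+1) * (2 - r + real k * (1 - r)) / (1 - r)^2)
      \<le> (M k - 1 / M k) * (s ^ (k+1) * (2 - s + real k * (1 - s)) / (1 - s)^2)"
    if "k \<in> {1..p-1}" for k
  proof (rule mult_left_mono)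
    have "r < 1" using assms by simp
    then show "r ^ (k+1) * (2 - r + real k * (1 - r)) / (1 - r)^2
        \<le> s ^ (k+1) * (2 - s + real k * (1 - s)) / (1 - s)^2"
      unfolding eq[OF \<open>r < 1\<close>] eq[OF \<open>s < 1\<close>]
      using assms(3-5) by (intro mult_mono add_mono power_mono divide_left_mono mult_pos_pos add_nonneg_nonneg) auto
    have "1 / M k < 1" using M[OF that] by simp
    then show "0 \<le> M k - 1 / M k" using M[OF that] by linarith
  qed
  have 3: "(real k + 1) * r ^ k \<le> (real k + 1) * s ^ k" for k
    using assms by (intro mult_left_mono power_mono) auto
  have "(\<Sum>k=1..p-1. (M k - 1 / M k) * (r ^ (k+1) * (2 - r + real k * (1 - r)) / (1 - r)^2))
      \<le> (\<Sum>k=1..p-1. (M k - 1 / M k) * (s ^ (k+1) * (2 - s + real k * (1 - s)) / (1 - s)^2))"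
    "(\<Sum>k=1..p-1. (real k + 1) * r ^ k) \<le> (\<Sum>k=1..p-1. (real k + 1) * s ^ k)"
    by (intro sum_mono 2 3; assumption)+
  with 1 show ?thesis
    unfolding radius_fun_def by linarith
qed

lemma radius_fun_0: "1 < \<Lambda> \<Longrightarrow> radius_fun p \<Lambda> M 0 = 1"
  unfolding radius_fun_def by simp

lemma disk_radius_0: "disk_radius p \<Lambda> M 0 = 0"
  by (simp add: disk_radius_def)

text \<open>Termwise differentiation, after the closed geometric term is expanded into powers
  \<open>x ^ (k+1)\<close>, whose derivatives form the last sum of
  \<open>radius_fun\<close>.\<close>

lemma disk_radius_has_derivative:
  assumes "1 < \<Lambda>" "0 \<le> r" "r < 1"
  shows "(disk_radius p \<Lambda> M has_real_derivative radius_fun p \<Lambda> M r) (at r)"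
proof -
  define G where "G = (\<lambda>x. \<Lambda>^2 * x + (\<Lambda>^3 - \<Lambda>) * ln (1 - x / \<Lambda>)
     - (\<Sum>k=1..p-1. (M k - 1 / M k) * (x ^ (k+2) / (1 - x))) - (\<Sum>k=1..p-1. x ^ (k+1)))"
  have eq: "G x = disk_radius p \<Lambda> M x" if "x < 1" for x
  proof -
    have "(\<Sum>k=1..p-1. x ^ (k+1)) = x^2 * (\<Sum>k<p-1. x ^ k)"
      by (simp add: sum_distrib_left sum.atLeast1_atMost_eq power_add power2_eq_square mult_ac)
    also have "\<dots> = x^2 * ((1 - x ^ (p-1)) / (1 - x))" using that by (simp add: sum_gp_strict)
    finally show ?thesis by (simp add: G_def disk_radius_def)
  qed
  have 1: "((\<lambda>x. \<Lambda>^2 * x + (\<Lambda>^3 - \<Lambda>) * ln (1 - x / \<Lambda>)) has_real_derivative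
      \<Lambda> * ((1 - \<Lambda> * r) / (\<Lambda> - r))) (at r)"
  proof -
    have eq: "1 - r / \<Lambda> = (\<Lambda> - r) / \<Lambda>" using assms by (simp add: field_simps)
    then have pos: "0 < 1 - r / \<Lambda>" using assms by simp
    have "((\<lambda>x. \<Lambda>^2 * x + (\<Lambda>^3 - \<Lambda>) * ln (1 - x / \<Lambda>)) has_real_derivative
        \<Lambda>^2 + (\<Lambda>^3 - \<Lambda>) * (- (1 / \<Lambda>) / (1 - r / \<Lambda>))) (at r)"
      using pos \<open>1 < \<Lambda>\<close> by (auto intro!: derivative_eq_intros)
    also have "- (1 / \<Lambda>) / (1 - r / \<Lambda>) = - 1 / (\<Lambda> - r)"
      unfolding eq using \<open>1 < \<Lambda>\<close> by (auto simp: divide_simps)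
    also have "\<Lambda>^2 + (\<Lambda>^3 - \<Lambda>) * (- 1 / (\<Lambda> - r)) = (\<Lambda>^2 * (\<Lambda> - r) - (\<Lambda>^3 - \<Lambda>)) / (\<Lambda> - r)"
      using assms by (simp add: diff_divide_distrib)
    also have "\<Lambda>^2 * (\<Lambda> - r) - (\<Lambda>^3 - \<Lambda>) = \<Lambda> * (1 - \<Lambda> * r)"
      by (simp add: power2_eq_square power3_eq_cube algebra_simps)
    finally show ?thesis by simp
  qed
  have 2: "((\<lambda>x. x ^ (k+2) / (1 - x)) has_real_derivative
      r ^ (k+1) * (2 - r + real k * (1 - r)) / (1 - r)^2) (at r)" for k
  proof -
    have "((\<lambda>x. x ^ (k+2) / (1 - x)) has_real_derivative
        ((real k + 2) * r ^ (k+1) * (1 - r) + r ^ (k+2)) / (1 - r)^2) (at r)"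
      using assms DERIV_divide[OF DERIV_pow[of "k+2" r] DERIV_diff[OF DERIV_const[of 1] DERIV_ident]]
      by (simp add: power2_eq_square add.commute)
    also have "(real k + 2) * r ^ (k+1) * (1 - r) + r ^ (k+2) = r ^ (k+1) * (2 - r + real k * (1 - r))"
      by (simp add: algebra_simps)
    finally show ?thesis .
  qed
  have 3: "((\<lambda>x. x ^ (k+1)) has_real_derivative (real k + 1) * r ^ k) (at r)" for k
    using DERIV_pow[of "k+1" r] by (simp add: add.commute)
  have "(G has_real_derivative radius_fun p \<Lambda> M r) (at r)"
    unfolding G_def radius_fun_def
    by (intro DERIV_diff DERIV_sum DERIV_cmult 1 2 3)
  \<comment> \<open>The expansion \<open>G\<close> agrees with \<open>disk_radius\<close> for
    \<open>x < 1\<close>, an open set containing \<open>r\<close>.\<close>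
  then show ?thesis
    by (rule has_field_derivative_transform_within_open[where S = "{..<1}"])
      (use assms eq in auto)
qed

section \<open>The real derivative of \<open>F\<close>, and the assembly of the result\<close>

text \<open>The summand \<open>k = 0\<close> contributes \<open>(cmod u)^2\<close> times the real
  part of \<open>A_0'\<close>, bounded below by Schwarz-Pick. The others are bounded in modulus, and
  their bounds add up to the sums subtracted in \<open>radius_fun\<close>.\<close>

lemma polyanalytic_sum_derivative:
  assumes "1 < \<Lambda>" and M: "\<And>k. k \<in> {1..p-1} \<Longrightarrow> M k > 1"
    and F: "\<And>z. z \<in> ball 0 1 \<Longrightarrow> F z = (\<Sum>k=0..p-1. cnj z ^ k * A k z)"
    and hol: "\<And>k. k \<in> {0..p-1} \<Longrightarrow> A k holomorphic_on ball 0 1"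
    and A0: "\<And>k. k \<in> {0..p-1} \<Longrightarrow> A k 0 = 0"
    and A1: "\<And>k. k \<in> {0..p-1} \<Longrightarrow> deriv (A k) 0 = 1"
    and bound0: "\<And>z. z \<in> ball 0 1 \<Longrightarrow> cmod (deriv (A 0) z) < \<Lambda>"
    and bound: "\<And>k z. k \<in> {1..p-1} \<Longrightarrow> z \<in> ball 0 1 \<Longrightarrow> cmod (A k z) \<le> M k"
    and z: "cmod z < 1"
  shows "\<exists>D. (F has_derivative D) (at z) \<and>
    (\<forall>u. (cmod u)^2 * radius_fun p \<Lambda> M (cmod z) \<le> u \<bullet> D u)"
proof -
  define r where "r = cmod z"
  have r: "0 \<le> r" "r < 1" using z by (auto simp: r_def)
  \<comment> \<open>The differential of \<open>cnj w ^ k * A k w\<close> by the product rule. At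
    \<open>k = 0\<close> the truncated exponent \<open>k - 1\<close> is harmless because of the
    factor \<open>of_nat k\<close>.\<close>
  define T where "T = (\<lambda>k u. cnj z ^ k * (deriv (A k) z * u) + of_nat k * cnj u * cnj z ^ (k - 1) * A k z)"
  have T: "((\<lambda>w. cnj w ^ k * A k w) has_derivative T k) (at z)" if "k \<in> {0..p-1}" for k
  proof -
    have A: "(A k has_derivative (*) (deriv (A k) z)) (at z)"
      using holomorphic_derivI[OF hol[OF that] open_ball, of z] z
      by (simp add: has_field_derivative_def)
    have C: "(cnj has_derivative cnj) (at z)"
      by (rule bounded_linear_imp_has_derivative) (rule bounded_linear_cnj)
    have P: "((\<lambda>w. cnj w ^ k) has_derivative (\<lambda>h. of_nat k * cnj h * cnj z ^ (k - 1))) (at z)"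
      using has_derivative_power[OF C, of k] by (simp add: mult_ac)
    show ?thesis unfolding T_def by (rule has_derivative_mult[OF P A])
  qed
  have "((\<lambda>w. \<Sum>k=0..p-1. cnj w ^ k * A k w) has_derivative (\<lambda>u. \<Sum>k=0..p-1. T k u)) (at z)"
    by (intro has_derivative_sum T)
  then have D: "(F has_derivative (\<lambda>u. \<Sum>k=0..p-1. T k u)) (at z)"
    by (rule has_derivative_transform_within_open[OF _ open_ball[of 0 1]]) (use z F in auto)
  have lower: "(cmod u)^2 * radius_fun p \<Lambda> M r \<le> u \<bullet> (\<Sum>k=0..p-1. T k u)" for u
  proof -
    let ?B = "\<lambda>k. (real k + 1) * r ^ k
      + (M k - 1 / M k) * (r ^ (k+1) * (2 - r + real k * (1 - r)) / (1 - r)^2)"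
    have "T 0 u = deriv (A 0) z * u" by (simp add: T_def)
    then have "u \<bullet> T 0 u = (cmod u)^2 * Re (deriv (A 0) z)"
      by (simp add: inner_complex_def cmod_power2) (simp add: power2_eq_square algebra_simps)
    \<comment> \<open>The real-part bound is used for \<open>deriv (A 0)\<close>, which has value 1
      at 0 and modulus below \<Lambda>.\<close>
    moreover have "\<Lambda> * (1 - \<Lambda> * r) / (\<Lambda> - r) \<le> Re (deriv (A 0) z)"
      unfolding r_def
      using hol[of 0] A1[of 0] bound0 \<open>1 < \<Lambda>\<close> z
      by (intro Re_ge_of_bounded) (auto intro!: holomorphic_deriv simp: less_imp_le)
    then have "(cmod u)^2 * (\<Lambda> * (1 - \<Lambda> * r) / (\<Lambda> - r)) \<le> (cmod u)^2 * Re (deriv (A 0) z)"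
      by (rule mult_left_mono) simp
    ultimately have 0: "(cmod u)^2 * (\<Lambda> * ((1 - \<Lambda> * r) / (\<Lambda> - r))) \<le> u \<bullet> T 0 u"
      by (simp only: times_divide_eq_right)
    have k: "- ((cmod u)^2 * ?B k) \<le> u \<bullet> T k u" if k: "k \<in> {1..p-1}" for k
    proof -
      have k0: "k \<in> {0..p-1}" using k by auto
      note est = bounded_holomorphic_estimates[OF hol[OF k0] A0[OF k0] A1[OF k0] bound[OF k] M[OF k] z]
      have "cmod (T k u) \<le> r ^ k * (cmod (deriv (A k) z) * cmod u)
          + real k * cmod u * r ^ (k - 1) * cmod (A k z)"
        unfolding T_def r_def by (rule order_trans[OF norm_triangle_ineq]) (simp add: norm_mult norm_power)
      also have "\<dots> = cmod u * (r ^ k * cmod (deriv (A k) z) + real k * r ^ (k - 1) * cmod (A k z))"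
        by (simp add: algebra_simps)
      also have "\<dots> \<le> cmod u * (r ^ k * (1 + (M k - 1 / M k) * (r * (2 - r) / (1 - r)^2))
          + real k * r ^ (k - 1) * (r + (M k - 1 / M k) * (r^2 / (1 - r))))"
        using est r unfolding r_def[symmetric]
        by (intro mult_left_mono add_mono) auto
      also have "r ^ k * (1 + (M k - 1 / M k) * (r * (2 - r) / (1 - r)^2))
          + real k * r ^ (k - 1) * (r + (M k - 1 / M k) * (r^2 / (1 - r))) = ?B k"
      proof -
        \<comment> \<open>Here k \<ge> 1 removes the truncated subtraction; with \<open>v\<close>
          for the inverse of \<open>(1 - r)^2\<close> the identity becomes polynomial.\<close>
        obtain j where j: "k = Suc j" using k by (cases k) auto
        define v c where "v = inverse ((1 - r)^2)" and "c = M (Suc j) - 1 / M (Suc j)"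
        have *: "r^2 / (1 - r) = r^2 * (1 - r) * v" using r by (simp add: v_def power2_eq_square divide_inverse)
        show ?thesis
          unfolding j unfolding * divide_inverse[of _ "(1 - r)^2"] v_def[symmetric] c_def[symmetric]
          by (simp add: power2_eq_square algebra_simps)
      qed
      finally have "cmod (T k u) \<le> cmod u * ?B k" .
      then have "cmod u * cmod (T k u) \<le> cmod u * (cmod u * ?B k)" by (rule mult_left_mono) simp
      moreover have "\<bar>u \<bullet> T k u\<bar> \<le> cmod u * cmod (T k u)" by (rule Cauchy_Schwarz_ineq2)
      ultimately show ?thesis by (simp only: power2_eq_square mult.assoc abs_le_iff) linarith
    qed
    have "radius_fun p \<Lambda> M r = \<Lambda> * ((1 - \<Lambda> * r) / (\<Lambda> - r)) - (\<Sum>k=1..p-1. ?B k)"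
      by (simp add: radius_fun_def sum.distrib)
    then have "(cmod u)^2 * radius_fun p \<Lambda> M r
      = (cmod u)^2 * (\<Lambda> * ((1 - \<Lambda> * r) / (\<Lambda> - r))) + (\<Sum>k=1..p-1. - ((cmod u)^2 * ?B k))"
      by (simp only: right_diff_distrib sum_distrib_left sum_negf)
    also have "\<dots> \<le> u \<bullet> T 0 u + (\<Sum>k=1..p-1. u \<bullet> T k u)"
      using 0 k by (intro add_mono sum_mono)
    also have "\<dots> = u \<bullet> (\<Sum>k=0..p-1. T k u)"
      by (simp add: sum.atLeast_Suc_atMost[of 0] inner_add_right inner_sum_right)
    finally show ?thesis .
  qed
  show ?thesis using D lower unfolding r_def by blast
qed

theorem theorem4:
  fixes p :: nat and \<Lambda> :: real and M :: "nat \<Rightarrow> real"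
    and F :: "complex \<Rightarrow> complex" and A :: "nat \<Rightarrow> complex \<Rightarrow> complex"
  assumes "p \<ge> 1"
    and "\<Lambda> > 1"
    and "\<And>k. k \<in> {1..p-1} \<Longrightarrow> M k > 1"
    and "polyanalytic_on p F (ball 0 1)"
    and "\<And>z. z \<in> ball 0 1 \<Longrightarrow> F z = (\<Sum>k=0..p-1. cnj z ^ k * A k z)"
    and "\<And>k. k \<in> {0..p-1} \<Longrightarrow> A k holomorphic_on ball 0 1"
    and "\<And>k. k \<in> {0..p-1} \<Longrightarrow> A k 0 = 0"
    and "\<And>k. k \<in> {0..p-1} \<Longrightarrow> deriv (A k) 0 = 1"
    and "\<And>z. z \<in> ball 0 1 \<Longrightarrow> cmod (deriv (A 0) z) < \<Lambda>"
    and "\<And>k z. k \<in> {1..p-1} \<Longrightarrow> z \<in> ball 0 1 \<Longrightarrow> cmod (A k z) \<le> M k"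
  shows "(\<exists>!r. r \<in> {0<..<1} \<and> radius_fun p \<Lambda> M r = 0) \<and>
    (\<forall>\<rho>. \<rho> \<in> {0<..<1} \<and> radius_fun p \<Lambda> M \<rho> = 0 \<longrightarrow>
       inj_on F (ball 0 \<rho>) \<and> schlicht_disk_in F (ball 0 \<rho>) 0 (disk_radius p \<Lambda> M \<rho>))"
proof (intro conjI allI impI)
  let ?S = "radius_fun p \<Lambda> M" and ?\<sigma> = "disk_radius p \<Lambda> M"
  note decr = radius_fun_strict_decreasing[of \<Lambda> p M, OF assms(2,3)]
  \<comment> \<open>The first term of \<open>radius_fun\<close> vanishes at
    \<open>1 / \<Lambda>\<close>, so the function is nonpositive there. Its value at 0 is 1, and the
    intermediate value theorem yields a root between.\<close>
  have l: "0 < 1 / \<Lambda>" "1 / \<Lambda> < 1" using \<open>\<Lambda> > 1\<close> by auto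
  have "0 \<le> (M k - 1 / M k) * ((1 / \<Lambda>) ^ (k+1) * (2 - 1 / \<Lambda> + real k * (1 - 1 / \<Lambda>)) / (1 - 1 / \<Lambda>)^2)"
    if "k \<in> {1..p-1}" for k
  proof -
    have "1 / M k < 1" using assms(3)[OF that] by simp
    then have "0 \<le> M k - 1 / M k" using assms(3)[OF that] by linarith
    moreover define x where "x = 1 / \<Lambda>"
    then have "0 \<le> x" "x < 1" using l by auto
    ultimately show ?thesis
      unfolding x_def[symmetric]
      by (intro mult_nonneg_nonneg divide_nonneg_nonneg add_nonneg_nonneg zero_le_power) auto
  qed
  then have "0 \<le> (\<Sum>k=1..p-1. (M k - 1 / M k) *
      ((1 / \<Lambda>) ^ (k+1) * (2 - 1 / \<Lambda> + real k * (1 - 1 / \<Lambda>)) / (1 - 1 / \<Lambda>)^2))"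
    by (intro sum_nonneg)
  moreover have "0 \<le> (\<Sum>k=1..p-1. (real k + 1) * (1 / \<Lambda>) ^ k)"
    using l by (intro sum_nonneg mult_nonneg_nonneg zero_le_power) auto
  moreover have "\<Lambda> * ((1 - \<Lambda> * (1 / \<Lambda>)) / (\<Lambda> - 1 / \<Lambda>)) = 0"
    using \<open>\<Lambda> > 1\<close> by simp
  ultimately have "?S (1 / \<Lambda>) \<le> 0"
    unfolding radius_fun_def by linarith
  moreover have "\<Lambda> - x \<noteq> 0" "(1 - x)^2 \<noteq> 0" if "x \<in> {0..1/\<Lambda>}" for x
  proof -
    have "x < 1" using that l unfolding atLeastAtMost_iff by linarith
    then show "\<Lambda> - x \<noteq> 0" "(1 - x)^2 \<noteq> 0" using \<open>\<Lambda> > 1\<close> by simp_all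
  qed
  then have "continuous_on {0..1/\<Lambda>} ?S"
    unfolding radius_fun_def[abs_def] by (intro continuous_intros ballI)
  ultimately obtain r where r: "0 \<le> r" "r \<le> 1 / \<Lambda>" "?S r = 0"
    using IVT2'[of ?S "1 / \<Lambda>" 0 0] l radius_fun_0[OF \<open>\<Lambda> > 1\<close>] by auto
  have "r \<noteq> 0" using r radius_fun_0[OF \<open>\<Lambda> > 1\<close>] by auto
  then have r01: "r \<in> {0<..<1}" using r(1,2) l(2) unfolding greaterThanLessThan_iff by linarith
  show "\<exists>!r. r \<in> {0<..<1} \<and> ?S r = 0"
  proof (rule ex1I[of _ r])
    fix s assume s: "s \<in> {0<..<1} \<and> ?S s = 0"
    then show "s = r"
      using decr[of r s] decr[of s r] r01 r by (metis greaterThanLessThan_iff less_irrefl less_le not_less_iff_gr_or_eq)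
  qed (use r r01 in auto)
  fix \<rho> assume \<rho>: "\<rho> \<in> {0<..<1} \<and> ?S \<rho> = 0"
  obtain D where D: "\<And>z. cmod z < 1 \<Longrightarrow> (F has_derivative D z) (at z)"
    "\<And>z u. cmod z < 1 \<Longrightarrow> (cmod u)^2 * ?S (cmod z) \<le> u \<bullet> D z u"
    using polyanalytic_sum_derivative[of \<Lambda> p M F A, OF assms(2,3,5-10)] by metis
  have pos: "0 < ?S t" if "0 \<le> t" "t < \<rho>" for t
    using decr[of t \<rho>] that \<rho> by auto
  show inj: "inj_on F (ball 0 \<rho>)"
  proof (rule inj_on_of_inner_derivative_pos[OF convex_ball])
    fix z u :: complex assume z: "z \<in> ball 0 \<rho>" and "u \<noteq> 0"
    then have "0 < (cmod u)^2 * ?S (cmod z)" using pos by simp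
    then show "0 < u \<bullet> D z u" using D(2)[of z u] z \<rho> by simp
  qed (use D \<rho> in auto)
  \<comment> \<open>The endpoint \<rho> is included because \<rho> < 1; the boundary estimate
    integrates up to it.\<close>
  have deriv: "(?\<sigma> has_real_derivative ?S t) (at t)" if "0 \<le> t" "t \<le> \<rho>" for t
    using disk_radius_has_derivative[OF \<open>\<Lambda> > 1\<close>] that \<rho> by auto
  show "schlicht_disk_in F (ball 0 \<rho>) 0 (?\<sigma> \<rho>)"
  proof (rule schlicht_disk_in_of_boundary_bound[OF _ inj])
    show "continuous_on (cball 0 \<rho>) F"
    proof (intro continuous_at_imp_continuous_on ballI)
      fix z :: complex assume "z \<in> cball 0 \<rho>"
      then have "cmod z < 1" using \<rho> by simp
      then show "isCont F z" by (rule has_derivative_continuous[OF D(1)])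
    qed
    show F0: "F 0 = 0" using assms(5,7) by simp
    show "0 < \<rho>" using \<rho> by simp
    have "continuous_on {0..\<rho>} ?\<sigma>"
      using deriv by (intro continuous_at_imp_continuous_on ballI DERIV_isCont) auto
    \<comment> \<open>The derivative \<open>?S\<close> vanishes at \<rho>, so strict growth of
      \<open>?\<sigma>\<close> is deduced from the open interval and continuity at the ends.\<close>
    moreover have "\<exists>d. (?\<sigma> has_real_derivative d) (at t) \<and> 0 < d" if "0 < t" "t < \<rho>" for t
      using deriv[of t] pos[of t] that by auto
    ultimately have "?\<sigma> 0 < ?\<sigma> \<rho>"
      using DERIV_pos_imp_increasing_open[OF \<open>0 < \<rho>\<close>] by blast
    then show "0 < ?\<sigma> \<rho>" by (simp add: disk_radius_0)
    show "?\<sigma> \<rho> \<le> cmod (F z)" if "cmod z = \<rho>" for z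
    proof (rule norm_ge_of_inner_derivative_ge[where F = F and z = z and D = D and g = ?\<sigma> and g' = ?S and \<rho> = \<rho>])
      show "(F has_derivative D w) (at w)" if "cmod w \<le> \<rho>" for w
        using D(1)[of w] that \<rho> by auto
      show "(cmod u)^2 * ?S (cmod w) \<le> u \<bullet> D w u" if "cmod w \<le> \<rho>" for w u
        using D(2)[of w u] that \<rho> by auto
    qed (use deriv F0 disk_radius_0 \<open>0 < \<rho>\<close> that in auto)
  qed
qed

end
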